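(* Consider the quadratic program $\min_{\theta}\bar J(\theta)=\frac12\theta^TE\theta+\theta^TF$ subject to $M\theta\le\gamma$, with $E\succ0$. Suppose that (Assumption 1.1) the quadratic program is feasible, i.e. $\mathcal X=\{\theta\mid M\theta\le\gamma\}\neq\varnothing$, and (Assumption 1.2) whenever a new constraint index $j$ is added to the active set, giving $\mathbb A^m_{\rm new}=\mathbb A^m_{\rm old}\cup\{j\}$, step 4.b of the imuQP algorithm always ensures that $M_{\mathbb A}$ has full row rank, i.e. linearly independent rows (so that $H_{\mathbb A}=M_{\mathbb A}E^{-1}M_{\mathbb A}^T\succ0$). Then the solution $\theta^*$ computed by the imuQP algorithm is feasible ($\theta^*\in\mathcal X$) and optimal (it minimizes $\bar J$ over $\mathcal X$).
   Context: Data: $E\in\mathbb R^{d\times d}$ symmetric, $E\succ0$; $F\in\mathbb R^{d}$; $M\in\mathbb R^{p\times d}$ with rows $m_1,\dots,m_p$; $\gamma\in\mathbb R^p$; $H=ME^{-1}M^T$ with entries $h_{ij}$ (here $d=Nn_u$). Inequalities between vectors are componentwise. The $n$-th constraint is $m_n\theta\le\gamma_n$. The active set $\mathbb A$ is an ordered list of $c=|\mathbb A|$ distinct constraint indices. $M_{\mathbb A}$ consists of the rows $m_n$, $n\in\mathbb A$; $H_{\mathbb A}=M_{\mathbb A}E^{-1}M_{\mathbb A}^T$ is the submatrix of $H$ with rows and columns in $\mathbb A$; $H_{\mathbb A,\rm col}$ consists of the columns of $H$ indexed by $\mathbb A$; $K_{\mathbb A}$ consists of the entries of $K_0=\gamma-M\theta_0$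 indexed by $\mathbb A$. For every active set, $\lambda_{\mathbb A}=-H_{\mathbb A}^{-1}K_{\mathbb A}\in\mathbb R^c$. The additive and subtractive inverse matrix updates (AIMU, SIMU) are exact formulas producing $H_{\mathbb A}^{-1}$ and $\lambda_{\mathbb A}=-H_{\mathbb A}^{-1}K_{\mathbb A}$ for the new active set when one index is appended to, respectively removed from, the list. Exact arithmetic is used; $\arg\min$, $\arg\max$ denote an index attaining the extremum. imuQP algorithm. 1. $\theta_0=-E^{-1}F$. 2. $K_0=\gamma-M\theta_0$. 3. Set iteration counter $m=1$, $K_{\min}=\min(K_0)$, $j=\arg\min(K_0)$, $\mathbb A=\varnothing$, $c=0$. If $K_{\min}\ge0$, set $\theta^*=\theta_0$ and return. 4. While $K_{\min}<0$: a. If $j\in\mathbb A$, break (exit loop 4). Otherwise $m\leftarrow m+1$, $c\leftarrow c+1$, append $j$ to the end of $\mathbb A$. b. If $c=1$: $H_{\mathbb A}^{-1}=1/h_{jj}$, $\lambda_{\mathbb A}=-H_{\mathbb A}^{-1}K_{\min}$. Otherwise, let $H_{\rm old}=H_{\mathbb A_{\rm old}}$ where $\mathbb A_{\rm old}$ is the active set before appending $j$, $\mathbf h=(h_{nj})_{n\in\mathbb A_{\rm old}}$, $h=h_{jj}$, and compute $y=H_{\rm old}^{-1}\mathbf h$, $q=h-\mathbf h^Ty$. If $q=0$: let $y_{\max}=\max(y)$, $f=\arg\max(y)$; if $y_{\max}\le0$, break (QP declared infeasible); otherwise remove the $f$-th entry from $\mathbb A$, $c\leftarrow c-1$, and update $H_{\mathbb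 A}^{-1},\lambda_{\mathbb A}$ first by SIMU (with the $f$-th entry removed) and then by AIMU (with $j$ appended). If $q\ne0$: update $H_{\mathbb A}^{-1},\lambda_{\mathbb A}$ by AIMU with $j$ appended. c. $\lambda_{\min}=\min(\lambda_{\mathbb A})$, $i=\arg\min(\lambda_{\mathbb A})$. d. While $\lambda_{\min}<0$: $m\leftarrow m+1$, $c\leftarrow c-1$, remove the $i$-th entry from $\mathbb A$, update $H_{\mathbb A}^{-1},\lambda_{\mathbb A}$ by SIMU, and recompute $\lambda_{\min}=\min(\lambda_{\mathbb A})$, $i=\arg\min(\lambda_{\mathbb A})$. e. $K=K_0+H_{\mathbb A,\rm col}\lambda_{\mathbb A}$. f. $K_{\min}=\min(K)$, $j=\arg\min(K)$. 5. $\theta^*=\theta_0-E^{-1}M_{\mathbb A}^T\lambda_{\mathbb A}$. $\mathbb A^m_{\rm old}$ and $\mathbb A^m_{\rm new}$ denote the active set before and after the addition or removal performed at iteration $m$; $\mathbb A^{m+1}_{\rm old}=\mathbb A^m_{\rm new}$, and $\mathbb A^1_{\rm new}=\varnothing$. *)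

theory Defs
  imports
    "Jordan_Normal_Form.DL_Rank"
    "Jordan_Normal_Form.Gauss_Jordan_Elimination"
    "HOL-Library.Extended_Real"
begin

section \<open>The quadratic program\<close>

definition positive_definite :: "real mat \<Rightarrow> bool" where
  "positive_definite E \<longleftrightarrow>
     (\<forall>x \<in> carrier_vec (dim_row E). x \<noteq> 0\<^sub>v (dim_row E) \<longrightarrow> 0 < x \<bullet> (E *\<^sub>v x))"

definition qp_cost :: "real mat \<Rightarrow> real vec \<Rightarrow> real vec \<Rightarrow> real" where
  "qp_cost E F \<theta> = 1 / 2 * (\<theta> \<bullet> (E *\<^sub>v \<theta>)) + \<theta> \<bullet> F"

text \<open>The order on vectors is the componentwise one.\<close>

definition qp_feasible_set :: "real mat \<Rightarrow> real vec \<Rightarrow> real vec set" where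
  "qp_feasible_set M \<gamma> = {\<theta> \<in> carrier_vec (dim_col M). M *\<^sub>v \<theta> \<le> \<gamma>}"

section \<open>Extrema of vectors and removal of list entries\<close>

text \<open>
  Extended reals give the minimum of the empty vector the value \<open>\<infinity>\<close>, so that the loop
  \<open>while \<lambda>\<^sub>m\<^sub>i\<^sub>n < 0\<close> stops when the active set has become empty. The maximum below is only
  taken over nonempty vectors.
\<close>

definition vec_min :: "real vec \<Rightarrow> ereal" where
  "vec_min v = (INF x \<in> set\<^sub>v v. ereal x)"

definition vec_max :: "real vec \<Rightarrow> ereal" where
  "vec_max v = (SUP x \<in> set\<^sub>v v. ereal x)"

text \<open>Ties are not resolved: any index attaining the extremum qualifies.\<close>

definition vec_arg_min :: "real vec \<Rightarrow> nat \<Rightarrow> bool" where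
  "vec_arg_min v i \<longleftrightarrow> is_arg_min (\<lambda>k. v $ k) (\<lambda>k. k < dim_vec v) i"

definition vec_arg_max :: "real vec \<Rightarrow> nat \<Rightarrow> bool" where
  "vec_arg_max v i \<longleftrightarrow> is_arg_max (\<lambda>k. v $ k) (\<lambda>k. k < dim_vec v) i"

definition remove_nth :: "nat \<Rightarrow> 'a list \<Rightarrow> 'a list" where
  "remove_nth i xs = take i xs @ drop (Suc i) xs"

section \<open>The imuQP algorithm\<close>

text \<open>
  Control points: \<open>Start\<close> is the situation after \<open>\<theta>\<^sub>0\<close> and \<open>K\<^sub>0\<close> have been computed,
  \<open>Outer A K\<close> the head of the outer loop (which adds constraints), \<open>Inner A\<close> the head of the
  inner loop (which removes them), \<open>Exit A\<close> the point reached on leaving the outer loop.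
  \<open>Solution \<theta>\<close> and \<open>Infeasible\<close> are the two possible final results.
\<close>

datatype imuqp_state =
    Start
  | Outer "nat list" "real vec"
  | Inner "nat list"
  | Exit "nat list"
  | Solution "real vec"
  | Infeasible

text \<open>Constraints are indexed by \<open>0, \<dots>, p - 1\<close>; an active set is an ordered list of indices.\<close>

locale imuqp =
  fixes E :: "real mat" and F :: "real vec" and M :: "real mat" and \<gamma> :: "real vec"
begin

text \<open>\<^const>\<open>mat_inverse\<close> returns an option, with value \<^const>\<open>None\<close> on singular matrices.\<close>

definition E_inv :: "real mat" where
  "E_inv = the (mat_inverse E)"

definition \<theta>\<^sub>0 :: "real vec" where
  "\<theta>\<^sub>0 = - (E_inv *\<^sub>v F)"

definition K\<^sub>0 :: "real vec" where
  "K\<^sub>0 = \<gamma> - M *\<^sub>v \<theta>\<^sub>0"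

definition H :: "real mat" where
  "H = M * E_inv * M\<^sup>T"

definition M_act :: "nat list \<Rightarrow> real mat" where
  "M_act A = mat_of_rows (dim_col M) (map (row M) A)"

definition H_act :: "nat list \<Rightarrow> real mat" where
  "H_act A = M_act A * E_inv * (M_act A)\<^sup>T"

definition H_col :: "nat list \<Rightarrow> real mat" where
  "H_col A = mat (dim_row M) (length A) (\<lambda>(n, k). H $$ (n, A ! k))"

definition K_act :: "nat list \<Rightarrow> real vec" where
  "K_act A = vec (length A) (\<lambda>k. K\<^sub>0 $ (A ! k))"

text \<open>
  The inverse of \<open>H_act A\<close> and the multipliers are functions of the active set: the additive
  and subtractive inverse matrix updates are exact formulas for precisely these quantities.
\<close>

definition H_act_inv :: "nat list \<Rightarrow> real mat" where
  "H_act_inv A = the (mat_inverse (H_act A))"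

definition multipliers :: "nat list \<Rightarrow> real vec" where
  "multipliers A = - (H_act_inv A *\<^sub>v K_act A)"

definition h_vec :: "nat list \<Rightarrow> nat \<Rightarrow> real vec" where
  "h_vec A j = vec (length A) (\<lambda>k. H $$ (A ! k, j))"

definition y_vec :: "nat list \<Rightarrow> nat \<Rightarrow> real vec" where
  "y_vec A j = H_act_inv A *\<^sub>v h_vec A j"

definition q_val :: "nat list \<Rightarrow> nat \<Rightarrow> real" where
  "q_val A j = H $$ (j, j) - h_vec A j \<bullet> y_vec A j"

text \<open>
  \<open>add_constraint A j r\<close>: adding the index \<open>j\<close> to the active set \<open>A\<close> either produces the
  new active set \<open>A'\<close>, \<open>r = Some A'\<close>, or leads to the declaration of infeasibility,
  \<open>r = None\<close>. Since \<open>y_vec A j\<close> has the length of \<open>A\<close>, a removed entry is never the appended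
  index \<open>j\<close> itself.
\<close>

inductive add_constraint :: "nat list \<Rightarrow> nat \<Rightarrow> nat list option \<Rightarrow> bool" where
  first: "add_constraint [] j (Some [j])"
| append: "\<lbrakk>A \<noteq> []; q_val A j \<noteq> 0\<rbrakk> \<Longrightarrow> add_constraint A j (Some (A @ [j]))"
| exchange: "\<lbrakk>A \<noteq> []; q_val A j = 0; vec_max (y_vec A j) > 0; vec_arg_max (y_vec A j) f\<rbrakk>
    \<Longrightarrow> add_constraint A j (Some (remove_nth f (A @ [j])))"
| no_exchange: "\<lbrakk>A \<noteq> []; q_val A j = 0; vec_max (y_vec A j) \<le> 0\<rbrakk> \<Longrightarrow> add_constraint A j None"

inductive step :: "imuqp_state \<Rightarrow> imuqp_state \<Rightarrow> bool" where
  return_initial: "vec_min K\<^sub>0 \<ge> 0 \<Longrightarrow> step Start (Solution \<theta>\<^sub>0)"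
| enter_loop: "vec_min K\<^sub>0 < 0 \<Longrightarrow> step Start (Outer [] K\<^sub>0)"
| break: "\<lbrakk>vec_min K < 0; vec_arg_min K j; j \<in> set A\<rbrakk> \<Longrightarrow> step (Outer A K) (Exit A)"
| add: "\<lbrakk>vec_min K < 0; vec_arg_min K j; j \<notin> set A; add_constraint A j (Some A')\<rbrakk>
    \<Longrightarrow> step (Outer A K) (Inner A')"
| declare_infeasible: "\<lbrakk>vec_min K < 0; vec_arg_min K j; j \<notin> set A; add_constraint A j None\<rbrakk>
    \<Longrightarrow> step (Outer A K) Infeasible"
| leave_loop: "vec_min K \<ge> 0 \<Longrightarrow> step (Outer A K) (Exit A)"
| remove: "\<lbrakk>vec_min (multipliers A) < 0; vec_arg_min (multipliers A) i\<rbrakk>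
    \<Longrightarrow> step (Inner A) (Inner (remove_nth i A))"
| update_K: "vec_min (multipliers A) \<ge> 0
    \<Longrightarrow> step (Inner A) (Outer A (K\<^sub>0 + H_col A *\<^sub>v multipliers A))"
| finish: "step (Exit A) (Solution (\<theta>\<^sub>0 - E_inv *\<^sub>v ((M_act A)\<^sup>T *\<^sub>v multipliers A)))"

definition reachable :: "imuqp_state \<Rightarrow> bool" where
  "reachable s \<longleftrightarrow> step\<^sup>*\<^sup>* Start s"

definition halts_in :: "imuqp_state \<Rightarrow> bool" where
  "halts_in s \<longleftrightarrow> reachable s \<and> (\<nexists>s'. step s s')"

definition full_row_rank :: "nat list \<Rightarrow> bool" where
  "full_row_rank A \<longleftrightarrow> vec_space.rank (length A) (M_act A) = length A"

text \<open>
  The only transitions from \<open>Outer\<close> to \<open>Inner\<close> are those adding a constraint; \<open>A'\<close> is the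
  active set after the addition, including a possible exchange.
\<close>

definition additions_full_row_rank :: bool where
  "additions_full_row_rank \<longleftrightarrow>
     (\<forall>A K A'. reachable (Outer A K) \<longrightarrow> step (Outer A K) (Inner A') \<longrightarrow> full_row_rank A')"

end

end

theory Submission
  imports Defs
begin

text \<open>
  As long as the active rows are linearly independent, the multipliers make the point
  \<open>\<theta> = \<theta>\<^sub>0 - E\<^sup>-\<^sup>1 M\<^sub>A\<^sup>T \<lambda>\<^sub>A\<close> the minimizer of the cost under the active constraints taken as
  equations, and \<open>K = \<gamma> - M \<theta>\<close> is its slack. So \<open>K\<close> vanishes on the active set, and the loop
  never breaks on an index that is already active. Infeasibility is never declared either: \<open>q = 0\<close>
  means that the new row is the combination of the active rows with coefficients \<open>y\<close>, and if
  moreover \<open>y \<le> 0\<close>, no feasible point exists. The outer loop is therefore left only when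
  \<open>K \<ge> 0\<close> and \<open>\<lambda>\<^sub>A \<ge> 0\<close>; together with complementary slackness these are the
  Karush-Kuhn-Tucker conditions, which suffice by convexity. Termination plays no role, since only
  final states are considered.
\<close>

section \<open>Linear algebra: full rank, surjectivity and inverses\<close>

text \<open>A maximal independent set of columns has \<open>rank A = n\<close> elements, hence is a
  basis of the whole space, so the columns span it.\<close>

lemma (in vec_space) full_rank_surj:
  assumes A: "A \<in> carrier_mat n nc" and rank: "rank A = n" and z: "z \<in> carrier_vec n"
  shows "\<exists>x \<in> carrier_vec nc. A *\<^sub>v x = z"
proof -
  have cols: "set (cols A) \<subseteq> carrier_vec n"
    using A cols_dim by blast
  have "\<exists>S. finite S \<and> maximal S (\<lambda>T. T \<subseteq> set (cols A) \<and> lin_indpt T) \<and> {} \<subseteq> S"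
    by (rule maximal_exists_superset[of "set (cols A)"]) (auto simp: lin_dep_def)
  then obtain S where S: "finite S" "maximal S (\<lambda>T. T \<subseteq> set (cols A) \<and> lin_indpt T)"
    by blast
  then have sub: "S \<subseteq> set (cols A)" and li: "lin_indpt S"
    by (auto simp: maximal_def)
  have "card S = n"
    using rank_card_indpt[OF A S(2)] rank by simp
  then have "basis S"
    using dim_li_is_basis[OF fin_dim S(1) _ li] sub cols by (auto simp: dim_is_n)
  then have "z \<in> span S"
    using z by (auto simp: basis_def)
  then have "z \<in> col_space A"
    unfolding col_space_def using span_is_monotone[OF sub] by blast
  then show ?thesis
    using A by (auto simp: col_space_eq[OF A])
qed

lemma mult_mat_uminus_vec:
  fixes A :: "'a :: ring mat"
  assumes "A \<in> carrier_mat nr nc" "v \<in> carrier_vec nc"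
  shows "A *\<^sub>v (- v) = - (A *\<^sub>v v)"
  using assms by (intro eq_vecI) auto

text \<open>A trivial kernel makes the determinant nonzero, so \<open>mat_inverse\<close> does not
  return \<open>None\<close> and \<open>the\<close> yields a true inverse. This serves both
  \<open>E\<close> and \<open>H_act A\<close>.\<close>

lemma mat_inverse_inj:
  fixes A :: "'a :: field mat"
  assumes A: "A \<in> carrier_mat n n"
    and inj: "\<And>v. v \<in> carrier_vec n \<Longrightarrow> A *\<^sub>v v = 0\<^sub>v n \<Longrightarrow> v = 0\<^sub>v n"
  shows "the (mat_inverse A) \<in> carrier_mat n n"
    and "A * the (mat_inverse A) = 1\<^sub>m n"
proof -
  have "det A \<noteq> 0"
    using det_0_iff_vec_prod_zero_field[OF A] inj by blast
  then have "A \<in> Units (ring_mat TYPE('a) n ())"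
    by (rule det_non_zero_imp_unit[OF A])
  then obtain B where "mat_inverse A = Some B"
    using mat_inverse(1)[OF A, of "()"] by blast
  from mat_inverse(2)[OF A this] this
  show "the (mat_inverse A) \<in> carrier_mat n n" "A * the (mat_inverse A) = 1\<^sub>m n"
    by auto
qed

section \<open>Extrema of vectors and removal of list entries\<close>

text \<open>For the empty vector both sides hold, the infimum being infinite; this is the case of an
  empty active set.\<close>

lemma vec_min_nonneg_iff: "0 \<le> vec_min v \<longleftrightarrow> (\<forall>i < dim_vec v. 0 \<le> v $ i)"
  by (auto simp: vec_min_def le_INF_iff vec_set_def)

lemma vec_max_nonpos_iff: "vec_max v \<le> 0 \<longleftrightarrow> (\<forall>i < dim_vec v. v $ i \<le> 0)"
  by (auto simp: vec_max_def SUP_le_iff vec_set_def)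

lemma vec_min_negE:
  assumes "vec_min v < 0"
  obtains i where "i < dim_vec v" "v $ i < 0"
  using assms vec_min_nonneg_iff[of v] by (meson not_le)

lemma vec_arg_min_less_dim: "vec_arg_min v i \<Longrightarrow> i < dim_vec v"
  by (simp add: vec_arg_min_def is_arg_min_def)

lemma vec_arg_min_neg:
  assumes "vec_min v < 0" "vec_arg_min v i"
  shows "v $ i < 0"
  using assms by (elim vec_min_negE) (force simp: vec_arg_min_def is_arg_min_def)

lemma ex_vec_arg_min:
  assumes "0 < dim_vec v"
  shows "\<exists>i. vec_arg_min v i"
proof -
  have "vec_arg_min v (arg_min_on (($) v) {..<dim_vec v})"
    using assms arg_min_if_finite[of "{..<dim_vec v}" "($) v"]
    by (auto simp: vec_arg_min_def is_arg_min_def)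
  then show ?thesis ..
qed

lemma ex_vec_arg_max:
  assumes "0 < dim_vec v"
  shows "\<exists>i. vec_arg_max v i"
proof -
  have "vec_arg_max v (arg_min_on (\<lambda>k. - v $ k) {..<dim_vec v})"
    using assms arg_min_if_finite[of "{..<dim_vec v}" "\<lambda>k. - v $ k"]
    by (auto simp: vec_arg_max_def is_arg_max_def)
  then show ?thesis ..
qed

lemma set_remove_nth_subset: "set (remove_nth i xs) \<subseteq> set xs"
  by (auto simp: remove_nth_def dest: in_set_takeD in_set_dropD)

lemma distinct_remove_nth:
  assumes "distinct xs"
  shows "distinct (remove_nth i xs)"
proof -
  have "set (take i xs) \<inter> set (drop (Suc i) xs) = {}"
    using assms by (intro set_take_disj_set_drop_if_distinct) auto
  then show ?thesis
    using assms by (auto simp: remove_nth_def)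
qed

section \<open>The quadratic forms of \<open>E\<close> and of its inverse\<close>

locale strictly_convex_qp = imuqp E F M \<gamma>
  for E :: "real mat" and F :: "real vec" and M :: "real mat" and \<gamma> :: "real vec" +
  fixes d p :: nat
  assumes E_carrier: "E \<in> carrier_mat d d"
    and F_carrier: "F \<in> carrier_vec d"
    and M_carrier: "M \<in> carrier_mat p d"
    and \<gamma>_carrier: "\<gamma> \<in> carrier_vec p"
    and E_sym: "E\<^sup>T = E"
    and E_pos: "positive_definite E"
begin

lemma E_quad_pos: "x \<in> carrier_vec d \<Longrightarrow> x \<noteq> 0\<^sub>v d \<Longrightarrow> 0 < x \<bullet> (E *\<^sub>v x)"
  using E_pos E_carrier by (auto simp: positive_definite_def)

lemma E_quad_nonneg: "x \<in> carrier_vec d \<Longrightarrow> 0 \<le> x \<bullet> (E *\<^sub>v x)"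
  using E_quad_pos[of x] E_carrier by (cases "x = 0\<^sub>v d") auto

lemma E_inv_mat: "E_inv \<in> carrier_mat d d" "E * E_inv = 1\<^sub>m d"
proof -
  have "v = 0\<^sub>v d" if "v \<in> carrier_vec d" "E *\<^sub>v v = 0\<^sub>v d" for v
    using E_quad_pos[OF that(1)] that by auto
  from mat_inverse_inj[OF E_carrier this]
  show "E_inv \<in> carrier_mat d d" "E * E_inv = 1\<^sub>m d"
    by (auto simp: E_inv_def)
qed

lemma E_inv_vec [simp]: "x \<in> carrier_vec d \<Longrightarrow> E_inv *\<^sub>v x \<in> carrier_vec d"
  using E_inv_mat(1) by auto

lemma E_vec [simp]: "x \<in> carrier_vec d \<Longrightarrow> E *\<^sub>v x \<in> carrier_vec d"
  using E_carrier by auto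

lemma row_M [simp]: "n < p \<Longrightarrow> row M n \<in> carrier_vec d"
  using M_carrier by auto

lemma E_E_inv: "x \<in> carrier_vec d \<Longrightarrow> E *\<^sub>v (E_inv *\<^sub>v x) = x"
  using assoc_mult_mat_vec[OF E_carrier E_inv_mat(1), of x] E_inv_mat(2) by simp

lemma E_scalar_sym:
  assumes "x \<in> carrier_vec d" "y \<in> carrier_vec d"
  shows "(E *\<^sub>v x) \<bullet> y = x \<bullet> (E *\<^sub>v y)"
  using transpose_vec_mult_scalar[OF E_carrier assms(2,1)] E_sym by simp

text \<open>Inherited from the symmetry of \<open>E\<close> by inserting
  \<open>E_inv *\<^sub>v x\<close> and \<open>E_inv *\<^sub>v y\<close> there.\<close>

lemma E_inv_scalar_sym:
  assumes "x \<in> carrier_vec d" "y \<in> carrier_vec d"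
  shows "(E_inv *\<^sub>v x) \<bullet> y = x \<bullet> (E_inv *\<^sub>v y)"
  using E_scalar_sym[of "E_inv *\<^sub>v x" "E_inv *\<^sub>v y"] assms by (simp add: E_E_inv)

text \<open>With \<open>v = E_inv *\<^sub>v x\<close>, the form of \<open>E_inv\<close> at
  \<open>x\<close> is the form of \<open>E\<close> at \<open>v\<close>, so definiteness passes to
  the inverse.\<close>

lemma E_inv_quad_zero:
  assumes x: "x \<in> carrier_vec d" and "x \<bullet> (E_inv *\<^sub>v x) = 0"
  shows "x = 0\<^sub>v d"
proof -
  have "(E_inv *\<^sub>v x) \<bullet> (E *\<^sub>v (E_inv *\<^sub>v x)) = 0"
    using assms by (simp add: E_E_inv E_inv_scalar_sym)
  then have "E_inv *\<^sub>v x = 0\<^sub>v d"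
    using E_quad_pos[of "E_inv *\<^sub>v x"] x by force
  then have "E *\<^sub>v 0\<^sub>v d = x"
    using E_E_inv[OF x] by simp
  then show ?thesis
    using E_carrier by auto
qed

lemma \<theta>\<^sub>0_carrier [simp]: "\<theta>\<^sub>0 \<in> carrier_vec d"
  using F_carrier by (simp add: \<theta>\<^sub>0_def)

section \<open>Active rows and the blocks of \<open>H\<close>\<close>

lemma M_act_carrier: "M_act A \<in> carrier_mat (length A) d"
  using M_carrier by (auto simp: M_act_def)

lemma M_act_vec [simp]: "x \<in> carrier_vec d \<Longrightarrow> M_act A *\<^sub>v x \<in> carrier_vec (length A)"
  using M_act_carrier[of A] by auto

lemma M_act_transpose_vec [simp]:
  "x \<in> carrier_vec (length A) \<Longrightarrow> (M_act A)\<^sup>T *\<^sub>v x \<in> carrier_vec d"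
  using M_act_carrier[of A] by auto

lemma row_M_act: "k < length A \<Longrightarrow> A ! k < p \<Longrightarrow> row (M_act A) k = row M (A ! k)"
  using M_carrier by (auto simp: M_act_def)

lemma index_M_act_vec:
  assumes "k < length A" "A ! k < p"
  shows "(M_act A *\<^sub>v x) $ k = row M (A ! k) \<bullet> x"
  using assms M_act_carrier[of A] by (simp add: row_M_act)

lemma M_act_scalar:
  assumes "x \<in> carrier_vec d" "y \<in> carrier_vec (length A)"
  shows "((M_act A)\<^sup>T *\<^sub>v y) \<bullet> x = y \<bullet> (M_act A *\<^sub>v x)"
  using transpose_vec_mult_scalar[OF M_act_carrier assms] .

lemma H_index:
  assumes "i < p" "j < p"
  shows "H $$ (i, j) = row M i \<bullet> (E_inv *\<^sub>v row M j)"
proof -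
  have "H = M * (E_inv * M\<^sup>T)"
    unfolding H_def using M_carrier E_inv_mat(1) by (intro assoc_mult_mat) auto
  moreover have "col (E_inv * M\<^sup>T) j = E_inv *\<^sub>v row M j"
    using assms M_carrier E_inv_mat(1) by (subst col_mult2) auto
  ultimately show ?thesis
    using assms M_carrier E_inv_mat(1) by simp
qed

lemma H_act_vec:
  assumes "x \<in> carrier_vec (length A)"
  shows "H_act A *\<^sub>v x = M_act A *\<^sub>v (E_inv *\<^sub>v ((M_act A)\<^sup>T *\<^sub>v x))"
proof -
  have "H_act A *\<^sub>v x = (M_act A * E_inv) *\<^sub>v ((M_act A)\<^sup>T *\<^sub>v x)"
    unfolding H_act_def using assms M_act_carrier[of A] E_inv_mat(1)
    by (intro assoc_mult_mat_vec) auto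
  also have "\<dots> = M_act A *\<^sub>v (E_inv *\<^sub>v ((M_act A)\<^sup>T *\<^sub>v x))"
    using assms by (intro assoc_mult_mat_vec[OF M_act_carrier E_inv_mat(1)]) simp
  finally show ?thesis .
qed

lemma H_act_carrier: "H_act A \<in> carrier_mat (length A) (length A)"
  using M_act_carrier[of A] by (auto simp: H_act_def)

text \<open>By symmetry of \<open>E_inv\<close>, row \<open>n\<close> of \<open>H_col A\<close> is
  \<open>M_act A *\<^sub>v (E_inv *\<^sub>v row M n)\<close>; moving \<open>M_act A\<close> and
  \<open>E_inv\<close> across the scalar product gives entry \<open>n\<close> of the right-hand
  side.\<close>

lemma H_col_vec:
  assumes A: "set A \<subseteq> {..<p}" and x: "x \<in> carrier_vec (length A)"
  shows "H_col A *\<^sub>v x = M *\<^sub>v (E_inv *\<^sub>v ((M_act A)\<^sup>T *\<^sub>v x))"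
proof (rule eq_vecI)
  fix n
  assume "n < dim_vec (M *\<^sub>v (E_inv *\<^sub>v ((M_act A)\<^sup>T *\<^sub>v x)))"
  then have n: "n < p"
    using M_carrier by simp
  have "row (H_col A) n = M_act A *\<^sub>v (E_inv *\<^sub>v row M n)"
  proof (rule eq_vecI)
    fix k
    assume "k < dim_vec (M_act A *\<^sub>v (E_inv *\<^sub>v row M n))"
    then have k: "k < length A"
      using M_act_carrier[of A] by simp
    then have Ak: "A ! k < p"
      using A by (auto dest: nth_mem)
    have "row (H_col A) n $ k = row M n \<bullet> (E_inv *\<^sub>v row M (A ! k))"
      using n k Ak M_carrier by (simp add: H_col_def H_index)
    also have "\<dots> = (E_inv *\<^sub>v row M n) \<bullet> row M (A ! k)"
      using n Ak by (simp add: E_inv_scalar_sym)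
    also have "\<dots> = row M (A ! k) \<bullet> (E_inv *\<^sub>v row M n)"
      using n Ak by (intro comm_scalar_prod[of _ d]) auto
    finally show "row (H_col A) n $ k = (M_act A *\<^sub>v (E_inv *\<^sub>v row M n)) $ k"
      using k Ak by (simp add: index_M_act_vec)
  qed (use M_act_carrier[of A] in \<open>simp add: H_col_def\<close>)
  then have "(H_col A *\<^sub>v x) $ n = (M_act A *\<^sub>v (E_inv *\<^sub>v row M n)) \<bullet> x"
    using n M_carrier by (simp add: H_col_def)
  also have "\<dots> = x \<bullet> (M_act A *\<^sub>v (E_inv *\<^sub>v row M n))"
    using n x by (intro comm_scalar_prod[of _ "length A"]) auto
  also have "\<dots> = ((M_act A)\<^sup>T *\<^sub>v x) \<bullet> (E_inv *\<^sub>v row M n)"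
    using n x by (simp add: M_act_scalar)
  also have "\<dots> = (E_inv *\<^sub>v ((M_act A)\<^sup>T *\<^sub>v x)) \<bullet> row M n"
    using n x by (simp add: E_inv_scalar_sym)
  also have "\<dots> = row M n \<bullet> (E_inv *\<^sub>v ((M_act A)\<^sup>T *\<^sub>v x))"
    using n x by (intro comm_scalar_prod[of _ d]) auto
  finally show "(H_col A *\<^sub>v x) $ n = (M *\<^sub>v (E_inv *\<^sub>v ((M_act A)\<^sup>T *\<^sub>v x))) $ n"
    using n M_carrier by simp
qed (use M_carrier in \<open>simp add: H_col_def\<close>)

section \<open>Linear independence of the active rows\<close>

text \<open>
  Linear independence of the active rows is expressed by solvability for every right-hand side:
  in this form it passes to subsets without any reindexing of coefficient vectors.
\<close>

definition regular :: "nat list \<Rightarrow> bool" where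
  "regular A \<longleftrightarrow> distinct A \<and> set A \<subseteq> {..<p} \<and>
     (\<forall>z. \<exists>v \<in> carrier_vec d. \<forall>n \<in> set A. row M n \<bullet> v = z n)"

lemma regular_remove_nth: "regular A \<Longrightarrow> regular (remove_nth i A)"
  unfolding regular_def
  using set_remove_nth_subset[of i A] distinct_remove_nth[of A i] by blast

lemma regular_Nil: "regular []"
  by (auto simp: regular_def intro: zero_carrier_vec)

text \<open>Full row rank makes \<open>M_act A\<close> surjective; the prescribed values
  \<open>z\<close> are listed in the order of \<open>A\<close> to form the right-hand side.\<close>

lemma regular_if_full_row_rank:
  assumes "full_row_rank A" "distinct A" "set A \<subseteq> {..<p}"
  shows "regular A"
proof -
  have "\<exists>v \<in> carrier_vec d. \<forall>n \<in> set A. row M n \<bullet> v = z n" for z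
  proof -
    have "vec (length A) (\<lambda>k. z (A ! k)) \<in> carrier_vec (length A)"
      by simp
    then obtain v where v: "v \<in> carrier_vec d" "M_act A *\<^sub>v v = vec (length A) (\<lambda>k. z (A ! k))"
      using vec_space.full_rank_surj[OF M_act_carrier] assms(1) by (metis full_row_rank_def)
    have "row M n \<bullet> v = z n" if n: "n \<in> set A" for n
    proof -
      obtain k where k: "k < length A" "A ! k = n"
        using n by (auto simp: in_set_conv_nth)
      then have "row M n \<bullet> v = (M_act A *\<^sub>v v) $ k"
        using n assms(3) by (subst index_M_act_vec) auto
      then show ?thesis
        using k by (simp add: v(2))
    qed
    then show ?thesis
      using v(1) by blast
  qed
  then show ?thesis
    using assms by (simp add: regular_def)
qed

text \<open>Surjectivity of \<open>M_act A\<close> provides \<open>v\<close> with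
  \<open>M_act A *\<^sub>v v = x\<close>; then the square of \<open>x\<close> is the scalar product
  of \<open>(M_act A)\<^sup>T *\<^sub>v x = 0\<close> with \<open>v\<close>.\<close>

lemma M_act_transpose_inj:
  assumes A: "regular A" and x: "x \<in> carrier_vec (length A)" and 0: "(M_act A)\<^sup>T *\<^sub>v x = 0\<^sub>v d"
  shows "x = 0\<^sub>v (length A)"
proof -
  have dist: "distinct A" and Ap: "set A \<subseteq> {..<p}"
    using A by (auto simp: regular_def)
  have "\<exists>v \<in> carrier_vec d. \<forall>n \<in> set A. row M n \<bullet> v = z n" for z
    using A by (simp add: regular_def)
  \<comment> \<open>The entries of \<open>x\<close> are indexed by position but \<open>z\<close> by
    constraint, so \<open>inv_into\<close> recovers the position of \<open>n\<close> in the distinct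
    list \<open>A\<close>.\<close>
  then obtain v where v: "v \<in> carrier_vec d"
    "\<forall>n \<in> set A. row M n \<bullet> v = x $ (inv_into {..<length A} ((!) A) n)"
    by meson
  have "M_act A *\<^sub>v v = x"
  proof (rule eq_vecI)
    fix k
    assume "k < dim_vec x"
    then have k: "k < length A"
      using x by simp
    have "inj_on ((!) A) {..<length A}"
      using dist by (simp add: inj_on_nth)
    then have "inv_into {..<length A} ((!) A) (A ! k) = k"
      using k by (intro inv_into_f_f) auto
    then show "(M_act A *\<^sub>v v) $ k = x $ k"
      using k v(2) Ap by (subst index_M_act_vec) (auto dest: nth_mem)
  qed (use x M_act_carrier[of A] in simp)
  then have "x \<bullet> x = 0"
    using M_act_scalar[OF v(1) x] 0 v(1) by simp
  then show ?thesis
    using x by (auto simp: scalar_prod_def sum_nonneg_eq_0_iff intro!: eq_vecI)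
qed

text \<open>The form of \<open>H_act A\<close> at \<open>x\<close> is the form of
  \<open>E_inv\<close> at \<open>(M_act A)\<^sup>T *\<^sub>v x\<close>, so a kernel vector of
  \<open>H_act A\<close> is killed by the injective \<open>(M_act A)\<^sup>T\<close>.\<close>

lemma H_act_inv_mat:
  assumes A: "regular A"
  shows "H_act_inv A \<in> carrier_mat (length A) (length A)"
    and "H_act A * H_act_inv A = 1\<^sub>m (length A)"
proof -
  have "x = 0\<^sub>v (length A)"
    if x: "x \<in> carrier_vec (length A)" and 0: "H_act A *\<^sub>v x = 0\<^sub>v (length A)" for x
  proof -
    have "((M_act A)\<^sup>T *\<^sub>v x) \<bullet> (E_inv *\<^sub>v ((M_act A)\<^sup>T *\<^sub>v x)) = x \<bullet> (H_act A *\<^sub>v x)"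
      using x by (simp add: H_act_vec M_act_scalar)
    then have "(M_act A)\<^sup>T *\<^sub>v x = 0\<^sub>v d"
      using x 0 by (intro E_inv_quad_zero) simp_all
    then show ?thesis
      by (rule M_act_transpose_inj[OF A x])
  qed
  from mat_inverse_inj[OF H_act_carrier this]
  show "H_act_inv A \<in> carrier_mat (length A) (length A)"
    "H_act A * H_act_inv A = 1\<^sub>m (length A)"
    by (auto simp: H_act_inv_def)
qed

lemma H_act_inv_vec:
  assumes A: "regular A" and x: "x \<in> carrier_vec (length A)"
  shows "H_act_inv A *\<^sub>v x \<in> carrier_vec (length A)"
    and "H_act A *\<^sub>v (H_act_inv A *\<^sub>v x) = x"
  using H_act_inv_mat[OF A] x assoc_mult_mat_vec[OF H_act_carrier H_act_inv_mat(1)[OF A] x] by auto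

lemma multipliers_carrier [simp]:
  assumes "regular A"
  shows "multipliers A \<in> carrier_vec (length A)"
  using H_act_inv_vec(1)[OF assms, of "K_act A"] by (simp add: multipliers_def K_act_def)

lemma H_act_multipliers:
  assumes A: "regular A"
  shows "H_act A *\<^sub>v multipliers A = - K_act A"
proof -
  have K: "K_act A \<in> carrier_vec (length A)"
    by (simp add: K_act_def)
  have "H_act A *\<^sub>v multipliers A = - (H_act A *\<^sub>v (H_act_inv A *\<^sub>v K_act A))"
    unfolding multipliers_def
    by (rule mult_mat_uminus_vec[OF H_act_carrier H_act_inv_vec(1)[OF A K]])
  then show ?thesis
    using H_act_inv_vec(2)[OF A K] by simp
qed

section \<open>The point of an active set and its optimality conditions\<close>

text \<open>The vector returned by \<open>finish\<close>, taken at every active set so that the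
  invariant of the loops can refer to it.\<close>

definition primal :: "nat list \<Rightarrow> real vec" where
  "primal A = \<theta>\<^sub>0 - E_inv *\<^sub>v ((M_act A)\<^sup>T *\<^sub>v multipliers A)"

lemma primal_carrier [simp]: "regular A \<Longrightarrow> primal A \<in> carrier_vec d"
  by (simp add: primal_def)

text \<open>Identifies the vector computed by \<open>update_K\<close> as a slack: by
  \<open>H_col_vec\<close>, the added term is \<open>M\<close> applied to the correction subtracted
  from \<open>\<theta>\<^sub>0\<close>.\<close>

lemma slack_primal:
  assumes A: "regular A"
  shows "K\<^sub>0 + H_col A *\<^sub>v multipliers A = \<gamma> - M *\<^sub>v primal A"
proof -
  let ?w = "E_inv *\<^sub>v ((M_act A)\<^sup>T *\<^sub>v multipliers A)"
  have "set A \<subseteq> {..<p}"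
    using A by (simp add: regular_def)
  then have "H_col A *\<^sub>v multipliers A = M *\<^sub>v ?w"
    using A by (simp add: H_col_vec)
  moreover have "M *\<^sub>v primal A = M *\<^sub>v \<theta>\<^sub>0 - M *\<^sub>v ?w"
    unfolding primal_def using A by (intro mult_minus_distrib_mat_vec[OF M_carrier]) auto
  ultimately show ?thesis
    using \<gamma>_carrier M_carrier by (auto simp: K\<^sub>0_def intro!: eq_vecI)
qed

text \<open>The equation \<open>H_act A *\<^sub>v multipliers A = - K_act A\<close> says that the
  correction cancels the slack of \<open>\<theta>\<^sub>0\<close> in each active row.\<close>

lemma active_primal:
  assumes A: "regular A" and k: "k < length A"
  shows "row M (A ! k) \<bullet> primal A = \<gamma> $ (A ! k)"
proof -
  let ?w = "E_inv *\<^sub>v ((M_act A)\<^sup>T *\<^sub>v multipliers A)"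
  have Ak: "A ! k < p"
    using A k by (auto simp: regular_def dest: nth_mem)
  have "row M (A ! k) \<bullet> ?w = (H_act A *\<^sub>v multipliers A) $ k"
    using A k Ak by (simp add: H_act_vec index_M_act_vec)
  also have "\<dots> = - (\<gamma> $ (A ! k) - row M (A ! k) \<bullet> \<theta>\<^sub>0)"
    using k Ak \<gamma>_carrier M_carrier by (simp add: H_act_multipliers[OF A] K_act_def K\<^sub>0_def)
  moreover have "row M (A ! k) \<bullet> primal A = row M (A ! k) \<bullet> \<theta>\<^sub>0 - row M (A ! k) \<bullet> ?w"
    unfolding primal_def using A Ak by (intro scalar_prod_minus_distrib[of _ d]) auto
  ultimately show ?thesis
    by simp
qed

lemma primal_Nil: "primal [] = \<theta>\<^sub>0"
proof -
  have "(M_act [])\<^sup>T *\<^sub>v multipliers [] = 0\<^sub>v d"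
    using M_act_carrier[of "[]"] multipliers_carrier[OF regular_Nil]
    by (intro eq_vecI) (auto simp: scalar_prod_def)
  moreover have "E_inv *\<^sub>v 0\<^sub>v d = 0\<^sub>v d"
    using E_inv_mat(1) by auto
  ultimately show ?thesis
    by (simp add: primal_def)
qed

text \<open>The left-hand side is the gradient of the cost at \<open>primal A\<close>, so the
  gradient of the Lagrangian vanishes.\<close>

lemma stationarity:
  assumes A: "regular A"
  shows "E *\<^sub>v primal A + F = - ((M_act A)\<^sup>T *\<^sub>v multipliers A)"
proof -
  let ?g = "(M_act A)\<^sup>T *\<^sub>v multipliers A"
  have g: "?g \<in> carrier_vec d"
    using A by simp
  have "E *\<^sub>v primal A = E *\<^sub>v \<theta>\<^sub>0 - E *\<^sub>v (E_inv *\<^sub>v ?g)"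
    unfolding primal_def using g by (intro mult_minus_distrib_mat_vec[OF E_carrier]) auto
  moreover have "E *\<^sub>v \<theta>\<^sub>0 = - (E *\<^sub>v (E_inv *\<^sub>v F))"
    unfolding \<theta>\<^sub>0_def by (rule mult_mat_uminus_vec[OF E_carrier E_inv_vec[OF F_carrier]])
  ultimately have "E *\<^sub>v primal A = - F - ?g"
    using g F_carrier by (simp add: E_E_inv)
  moreover have "- F - ?g + F = - ?g"
    using F_carrier g by (intro eq_vecI) (auto simp del: index_mult_mat_vec dim_mult_mat_vec)
  ultimately show ?thesis
    by simp
qed

text \<open>The exact second-order expansion; symmetry of \<open>E\<close> merges the two mixed
  terms.\<close>

lemma qp_cost_expand:
  assumes x: "x \<in> carrier_vec d" and u: "u \<in> carrier_vec d"
  shows "qp_cost E F (x + u) = qp_cost E F x + (E *\<^sub>v x + F) \<bullet> u + 1 / 2 * (u \<bullet> (E *\<^sub>v u))"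
proof -
  have *: "x \<bullet> (E *\<^sub>v u) = (E *\<^sub>v x) \<bullet> u" "u \<bullet> (E *\<^sub>v x) = (E *\<^sub>v x) \<bullet> u" "u \<bullet> F = F \<bullet> u"
    using x u F_carrier E_scalar_sym[OF x u] comm_scalar_prod[of u d] by auto
  have "(x + u) \<bullet> (E *\<^sub>v (x + u)) = x \<bullet> (E *\<^sub>v x) + 2 * ((E *\<^sub>v x) \<bullet> u) + u \<bullet> (E *\<^sub>v u)"
    using x u * by (simp add: mult_add_distrib_mat_vec[OF E_carrier]
        add_scalar_prod_distrib[of _ d] scalar_prod_add_distrib[of _ d])
  then show ?thesis
    using x u * F_carrier by (simp add: qp_cost_def add_scalar_prod_distrib[of _ d] algebra_simps)
qed

text \<open>Active constraints are tight at \<open>primal A\<close>, so none increases on the way to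
  \<theta>'. With nonnegative multipliers, stationarity makes the linear term of the expansion
  nonnegative, and the quadratic term is nonnegative by convexity.\<close>

lemma primal_optimal:
  assumes A: "regular A" and nonneg: "0 \<le> vec_min (multipliers A)"
    and \<theta>': "\<theta>' \<in> qp_feasible_set M \<gamma>"
  shows "qp_cost E F (primal A) \<le> qp_cost E F \<theta>'"
proof -
  let ?u = "\<theta>' - primal A"
  have \<theta>'_carrier: "\<theta>' \<in> carrier_vec d" and le: "M *\<^sub>v \<theta>' \<le> \<gamma>"
    using \<theta>' M_carrier by (auto simp: qp_feasible_set_def)
  have u: "?u \<in> carrier_vec d"
    using A \<theta>'_carrier by simp
  have "multipliers A \<bullet> (M_act A *\<^sub>v ?u) \<le> 0"
  proof -
    have "multipliers A $ k * (M_act A *\<^sub>v ?u) $ k \<le> 0" if k: "k < length A" for k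
    proof (rule mult_nonneg_nonpos)
      show "0 \<le> multipliers A $ k"
        using nonneg k multipliers_carrier[OF A] by (simp add: vec_min_nonneg_iff)
      have Ak: "A ! k < p"
        using A k by (auto simp: regular_def dest: nth_mem)
      have "row M (A ! k) \<bullet> ?u = row M (A ! k) \<bullet> \<theta>' - \<gamma> $ (A ! k)"
        using A k Ak \<theta>'_carrier
        by (simp add: scalar_prod_minus_distrib[of _ d] active_primal)
      moreover have "row M (A ! k) \<bullet> \<theta>' \<le> \<gamma> $ (A ! k)"
        using le Ak M_carrier \<gamma>_carrier by (auto simp: less_eq_vec_def)
      ultimately show "(M_act A *\<^sub>v ?u) $ k \<le> 0"
        using k Ak by (simp add: index_M_act_vec)
    qed
    then show ?thesis
      using M_act_carrier[of A] by (auto simp: scalar_prod_def intro!: sum_nonpos)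
  qed
  then have "0 \<le> (E *\<^sub>v primal A + F) \<bullet> ?u"
    using A u by (simp add: stationarity M_act_scalar uminus_scalar_prod[symmetric, of _ d])
  moreover have "primal A + ?u = \<theta>'"
    using primal_carrier[OF A] \<theta>'_carrier by (auto intro!: eq_vecI)
  ultimately show ?thesis
    using qp_cost_expand[OF primal_carrier[OF A] u] E_quad_nonneg[OF u] by simp
qed

lemma primal_feasible:
  assumes "regular A" "0 \<le> vec_min (\<gamma> - M *\<^sub>v primal A)"
  shows "primal A \<in> qp_feasible_set M \<gamma>"
  using assms M_carrier \<gamma>_carrier
  by (auto simp: qp_feasible_set_def less_eq_vec_def vec_min_nonneg_iff)

section \<open>Schur complement and detection of infeasibility\<close>

text \<open>In the inner product given by \<open>E_inv\<close>, \<open>w\<close> is what remains of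
  row \<open>j\<close> after orthogonal projection onto the span of the active rows;
  \<open>q_val\<close> is its squared length.\<close>

lemma schur_complement:
  assumes A: "regular A" and j: "j < p"
  defines "w \<equiv> row M j - (M_act A)\<^sup>T *\<^sub>v y_vec A j"
  shows "q_val A j = w \<bullet> (E_inv *\<^sub>v w)"
proof -
  let ?c = "length A" and ?m = "row M j" and ?y = "y_vec A j"
  let ?g = "(M_act A)\<^sup>T *\<^sub>v ?y"
  have h: "h_vec A j = M_act A *\<^sub>v (E_inv *\<^sub>v ?m)"
    using A j M_act_carrier[of A]
    by (auto simp: h_vec_def regular_def H_index index_M_act_vec subset_eq intro!: eq_vecI
        simp del: index_mult_mat_vec)
  have h_carrier: "h_vec A j \<in> carrier_vec ?c"
    by (simp add: h_vec_def)
  have y: "?y \<in> carrier_vec ?c" and Hy: "H_act A *\<^sub>v ?y = h_vec A j"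
    unfolding y_vec_def by (rule H_act_inv_vec[OF A h_carrier])+
  have g: "?g \<in> carrier_vec d" and m: "?m \<in> carrier_vec d"
    using y j by auto
  have w: "w \<in> carrier_vec d"
    using g m by (simp add: w_def)
  have Ew: "E_inv *\<^sub>v w = E_inv *\<^sub>v ?m - E_inv *\<^sub>v ?g"
    unfolding w_def by (rule mult_minus_distrib_mat_vec[OF E_inv_mat(1) m g])
  \<comment> \<open>The equation \<open>Hy\<close> for \<open>?y\<close> is the normal equation of
    this projection: it makes \<open>w\<close> orthogonal to every active row.\<close>
  have "M_act A *\<^sub>v (E_inv *\<^sub>v w) = h_vec A j - H_act A *\<^sub>v ?y"
    using m g y by (simp add: Ew h H_act_vec mult_minus_distrib_mat_vec[OF M_act_carrier])
  then have "M_act A *\<^sub>v (E_inv *\<^sub>v w) = 0\<^sub>v ?c"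
    using Hy h_carrier by simp
  then have "?g \<bullet> (E_inv *\<^sub>v w) = 0"
    using w y by (simp add: M_act_scalar)
  then have "w \<bullet> (E_inv *\<^sub>v w) = ?m \<bullet> (E_inv *\<^sub>v w)"
    unfolding w_def using m g w by (subst minus_scalar_prod_distrib[of _ d]) (auto simp: w_def)
  also have "\<dots> = H $$ (j, j) - ?m \<bullet> (E_inv *\<^sub>v ?g)"
    using m g j by (simp add: Ew scalar_prod_minus_distrib[of _ d] H_index)
  also have "?m \<bullet> (E_inv *\<^sub>v ?g) = ?g \<bullet> (E_inv *\<^sub>v ?m)"
    using m g comm_scalar_prod[of ?g d "E_inv *\<^sub>v ?m"] by (simp add: E_inv_scalar_sym)
  also have "\<dots> = h_vec A j \<bullet> ?y"
    using m y h_carrier comm_scalar_prod[of ?y ?c "h_vec A j"] by (simp add: M_act_scalar h)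
  finally show ?thesis
    by (simp add: q_val_def)
qed

text \<open>
  Here \<open>m\<^sub>j\<close> is a combination of the active rows with nonpositive coefficients, so
  every feasible point would satisfy \<open>m\<^sub>j \<theta>' \<ge> m\<^sub>j \<theta> > \<gamma>\<^sub>j\<close>.
\<close>

lemma qp_infeasible:
  assumes A: "regular A" and j: "j < p" and q: "q_val A j = 0"
    and y: "vec_max (y_vec A j) \<le> 0"
    and violated: "\<gamma> $ j < row M j \<bullet> primal A"
  shows "qp_feasible_set M \<gamma> = {}"
proof (rule equals0I)
  fix \<theta>'
  assume "\<theta>' \<in> qp_feasible_set M \<gamma>"
  then have \<theta>': "\<theta>' \<in> carrier_vec d" and le: "row M n \<bullet> \<theta>' \<le> \<gamma> $ n" if "n < p" for n
    using that M_carrier \<gamma>_carrier by (auto simp: qp_feasible_set_def less_eq_vec_def)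
  let ?y = "y_vec A j"
  have y_carrier: "?y \<in> carrier_vec (length A)"
    unfolding y_vec_def by (rule H_act_inv_vec(1)[OF A]) (simp add: h_vec_def)
  have g: "(M_act A)\<^sup>T *\<^sub>v ?y \<in> carrier_vec d" and m: "row M j \<in> carrier_vec d"
    using y_carrier j by auto
  \<comment> \<open>A residual of squared length \<open>q_val A j = 0\<close> vanishes by
    definiteness.\<close>
  have "row M j - (M_act A)\<^sup>T *\<^sub>v ?y = 0\<^sub>v d"
    using schur_complement[OF A j] q g m by (intro E_inv_quad_zero) auto
  then have "(row M j - (M_act A)\<^sup>T *\<^sub>v ?y) + (M_act A)\<^sup>T *\<^sub>v ?y = 0\<^sub>v d + (M_act A)\<^sup>T *\<^sub>v ?y"
    by simp
  then have row: "row M j = (M_act A)\<^sup>T *\<^sub>v ?y"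
    using g m by (simp add: minus_add_uminus_vec[of _ d] assoc_add_vec[of _ d])
  have comb: "row M j \<bullet> x = (\<Sum>k < length A. ?y $ k * (row M (A ! k) \<bullet> x))"
    if "x \<in> carrier_vec d" for x
  proof -
    have "row M j \<bullet> x = ?y \<bullet> (M_act A *\<^sub>v x)"
      using that y_carrier by (simp add: row M_act_scalar)
    also have "\<dots> = (\<Sum>k < length A. ?y $ k * (row M (A ! k) \<bullet> x))"
      unfolding scalar_prod_def[of ?y] using A M_act_carrier[of A]
      by (intro sum.cong) (auto simp: index_M_act_vec regular_def subset_eq
          simp del: index_mult_mat_vec)
    finally show ?thesis .
  qed
  \<comment> \<open>Active constraints are equalities at \<open>primal A\<close>, so their values at
    \<theta>' are no larger; the nonpositive coefficients reverse the comparison.\<close>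
  have "(\<Sum>k < length A. ?y $ k * (row M (A ! k) \<bullet> primal A))
      \<le> (\<Sum>k < length A. ?y $ k * (row M (A ! k) \<bullet> \<theta>'))"
  proof (rule sum_mono)
    fix k
    assume "k \<in> {..<length A}"
    then have k: "k < length A"
      by simp
    then have "row M (A ! k) \<bullet> \<theta>' \<le> row M (A ! k) \<bullet> primal A"
      using A by (auto simp: active_primal regular_def subset_eq intro!: le)
    moreover have "?y $ k \<le> 0"
      using y k y_carrier by (simp add: vec_max_nonpos_iff)
    ultimately show "?y $ k * (row M (A ! k) \<bullet> primal A) \<le> ?y $ k * (row M (A ! k) \<bullet> \<theta>')"
      by (intro mult_left_mono_neg)
  qed
  then have "row M j \<bullet> primal A \<le> row M j \<bullet> \<theta>'"
    using A \<theta>'[OF j] by (simp add: comb)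
  then show False
    using violated le[OF j] by simp
qed

section \<open>The transition system: invariant and progress\<close>

text \<open>The rules exhaust all cases once a maximizing index exists; regularity gives
  \<open>y_vec A j\<close> the length of \<open>A\<close>, so it is nonempty when \<open>A\<close>
  is.\<close>

lemma add_constraint_progress:
  assumes A: "regular A"
  shows "\<exists>r. add_constraint A j r"
proof -
  have "\<exists>f. vec_arg_max (y_vec A j) f" if "A \<noteq> []"
    using that H_act_inv_vec(1)[OF A, of "h_vec A j"]
    by (intro ex_vec_arg_max) (auto simp: y_vec_def h_vec_def simp del: dim_mult_mat_vec)
  then show ?thesis
    by (cases "A = []"; cases "q_val A j = 0"; cases "vec_max (y_vec A j) \<le> 0")
      (auto intro: add_constraint.intros simp: not_le)
qed

text \<open>Supplies the part of \<open>regular\<close> that the rank assumption does not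
  state.\<close>

lemma add_constraint_indices:
  assumes "add_constraint A j (Some A')" "distinct A" "set A \<subseteq> {..<p}" "j \<notin> set A" "j < p"
  shows "distinct A' \<and> set A' \<subseteq> {..<p}"
  using assms
proof cases
  case (exchange f)
  then show ?thesis
    using assms set_remove_nth_subset[of f "A @ [j]"]
    by (auto intro!: distinct_remove_nth)
qed auto

text \<open>The multipliers may be negative at \<open>Inner\<close>, and the inner loop ends only
  when they are not, hence the extra condition at \<open>Outer\<close> and \<open>Exit\<close>. The
  value \<open>False\<close> at \<open>Infeasible\<close> expresses that this state is never
  reached.\<close>

fun invariant :: "imuqp_state \<Rightarrow> bool" where
  "invariant Start \<longleftrightarrow> True"
| "invariant (Outer A K) \<longleftrightarrow>
     regular A \<and> K = \<gamma> - M *\<^sub>v primal A \<and> 0 \<le> vec_min (multipliers A)"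
| "invariant (Inner A) \<longleftrightarrow> regular A"
| "invariant (Exit A) \<longleftrightarrow>
     regular A \<and> 0 \<le> vec_min (\<gamma> - M *\<^sub>v primal A) \<and> 0 \<le> vec_min (multipliers A)"
| "invariant (Solution \<theta>) \<longleftrightarrow> \<theta> \<in> qp_feasible_set M \<gamma> \<and>
     (\<forall>\<theta>' \<in> qp_feasible_set M \<gamma>. qp_cost E F \<theta> \<le> qp_cost E F \<theta>')"
| "invariant Infeasible \<longleftrightarrow> False"

lemma multipliers_Nil: "0 \<le> vec_min (multipliers [])"
  using multipliers_carrier[OF regular_Nil] by (simp add: vec_min_nonneg_iff)

lemma K\<^sub>0_primal: "K\<^sub>0 = \<gamma> - M *\<^sub>v primal []"
  by (simp add: K\<^sub>0_def primal_Nil)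

text \<open>Reachability of \<open>s\<close> is assumed along with the invariant because the rank
  assumption speaks of reachable states only.\<close>

lemma step_invariant:
  assumes step: "step s s'" and inv: "invariant s" and reach: "reachable s"
    and feas: "qp_feasible_set M \<gamma> \<noteq> {}" and rank: additions_full_row_rank
  shows "invariant s'"
  using step
proof cases
  case return_initial
  then show ?thesis
    using primal_feasible[OF regular_Nil] primal_optimal[OF regular_Nil multipliers_Nil]
    by (simp add: K\<^sub>0_primal primal_Nil)
next
  case enter_loop
  then show ?thesis
    using K\<^sub>0_primal regular_Nil multipliers_Nil by simp
next
  case (break K j A)
  have A: "regular A" and K: "K = \<gamma> - M *\<^sub>v primal A"
    using inv break by auto
  \<comment> \<open>This case is contradictory: the slack of \<open>j\<close> is negative by the
    choice of \<open>j\<close>, yet zero because \<open>j\<close> is active.\<close>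
  have "K $ j < 0"
    using break vec_arg_min_neg by blast
  moreover obtain k where "k < length A" "A ! k = j"
    using break(5) by (auto simp: in_set_conv_nth)
  then have "row M j \<bullet> primal A = \<gamma> $ j"
    using active_primal[OF A] by blast
  moreover have "j < p"
    using A break by (auto simp: regular_def)
  ultimately show ?thesis
    using K M_carrier \<gamma>_carrier by simp
next
  case (add K j A A')
  have A: "regular A" and K: "K = \<gamma> - M *\<^sub>v primal A"
    using inv add by auto
  have "full_row_rank A'"
    using rank reach step add unfolding additions_full_row_rank_def by blast
  moreover have "j < p"
    using vec_arg_min_less_dim[OF add(4)] K M_carrier by simp
  then have "distinct A' \<and> set A' \<subseteq> {..<p}"
    using A add by (intro add_constraint_indices[of A j]) (auto simp: regular_def)
  ultimately show ?thesis
    using add by (simp add: regular_if_full_row_rank)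
next
  case (declare_infeasible K j A)
  have A: "regular A" and K: "K = \<gamma> - M *\<^sub>v primal A"
    using inv declare_infeasible by auto
  have j: "j < p"
    using vec_arg_min_less_dim[OF declare_infeasible(4)] K M_carrier by simp
  have "K $ j < 0"
    using declare_infeasible vec_arg_min_neg by blast
  then have "\<gamma> $ j < row M j \<bullet> primal A"
    using j K M_carrier \<gamma>_carrier by simp
  then show ?thesis
    using declare_infeasible(6) qp_infeasible[OF A j] feas by (auto elim: add_constraint.cases)
next
  case (leave_loop K A)
  then show ?thesis
    using inv by auto
next
  case (remove A i)
  then show ?thesis
    using inv by (simp add: regular_remove_nth)
next
  case (update_K A)
  then show ?thesis
    using inv by (simp add: slack_primal)
next
  case (finish A)
  then show ?thesis
    using inv primal_feasible primal_optimal by (simp add: primal_def)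
qed

lemma reachable_invariant:
  assumes "reachable s" "qp_feasible_set M \<gamma> \<noteq> {}" additions_full_row_rank
  shows "invariant s"
  using assms(1) unfolding reachable_def
proof (induction rule: rtranclp_induct)
  case (step s s')
  then show ?case
    using step_invariant assms(2,3) by (simp add: reachable_def)
qed simp

text \<open>A negative minimum forces the vector to be nonempty, so a minimizing index exists in
  both loops; \<open>Infeasible\<close> is excluded by the invariant.\<close>

lemma progress:
  assumes "invariant s"
  shows "(\<exists>\<theta>. s = Solution \<theta>) \<or> (\<exists>s'. step s s')"
proof (cases s)
  case Start
  then show ?thesis
    using step.intros(1,2) not_le by blast
next
  case (Outer A K)
  show ?thesis
  proof (cases "vec_min K < 0")
    case True
    then obtain j where j: "vec_arg_min K j"
      using ex_vec_arg_min[of K] by (metis vec_min_negE gr_implies_not0 gr_zeroI)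
    obtain r where "add_constraint A j r"
      using add_constraint_progress assms Outer by auto
    then show ?thesis
      using Outer True j by (cases "j \<in> set A"; cases r) (auto intro: step.intros)
  qed (auto simp: Outer not_less intro: step.intros)
next
  case (Inner A)
  show ?thesis
  proof (cases "vec_min (multipliers A) < 0")
    case True
    then obtain i where "vec_arg_min (multipliers A) i"
      using ex_vec_arg_min[of "multipliers A"] by (metis vec_min_negE gr_implies_not0 gr_zeroI)
    then show ?thesis
      using Inner True by (auto intro: step.intros)
  qed (auto simp: Inner not_less intro: step.intros)
qed (use assms in \<open>auto intro: step.intros\<close>)

end

theorem theorem2:
  fixes E M :: "real mat" and F \<gamma> :: "real vec" and d p :: nat
  assumes "E \<in> carrier_mat d d" and "F \<in> carrier_vec d"
    and "M \<in> carrier_mat p d" and "\<gamma> \<in> carrier_vec p"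
    and "E\<^sup>T = E" and "positive_definite E"
    and "qp_feasible_set M \<gamma> \<noteq> {}"
    and "imuqp.additions_full_row_rank E F M \<gamma>"
  shows "\<forall>s. imuqp.halts_in E F M \<gamma> s \<longrightarrow>
    (\<exists>\<theta>. s = Solution \<theta> \<and> \<theta> \<in> qp_feasible_set M \<gamma> \<and>
         (\<forall>\<theta>' \<in> qp_feasible_set M \<gamma>. qp_cost E F \<theta> \<le> qp_cost E F \<theta>'))"
proof (intro allI impI)
  interpret strictly_convex_qp E F M \<gamma> d p
    by unfold_locales (use assms in auto)
  fix s
  assume "halts_in s"
  then have reach: "reachable s" and halt: "\<nexists>s'. step s s'"
    by (auto simp: halts_in_def)
  have "invariant s"
    using reachable_invariant[OF reach] assms(7,8) by simp
  \<comment> \<open>A halting state has no successor, so \<open>progress\<close> leaves only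
    \<open>Solution\<close>, where the invariant is the claim.\<close>
  with progress[OF this] halt
  show "\<exists>\<theta>. s = Solution \<theta> \<and> \<theta> \<in> qp_feasible_set M \<gamma> \<and>
      (\<forall>\<theta>' \<in> qp_feasible_set M \<gamma>. qp_cost E F \<theta> \<le> qp_cost E F \<theta>')"
    by auto
qed

end
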